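(* Fix an integer $d\ge3$, and let $G_n$ be the random $d$-regular graph on $n$ vertices, with law $p_{d,n}$. Then for every $\varepsilon>0$ there exists $\eta=\eta(d,\varepsilon)>0$ such that $$p_{d,n}\Bigl(\forall S\subset[n]\text{ with }|S|\le\eta n:\ e_{G_n}(S)\le(1+\varepsilon)|S|\Bigr)\xrightarrow[n\to\infty]{}1.$$
   Context: $[n]=\{1,\dots,n\}$. The random $d$-regular graph on $[n]$ is chosen uniformly from all simple graphs on $[n]$ in which every vertex has degree exactly $d$; only $n$ with $nd$ even are considered. $e_G(S)$ is the number of edges of $G$ with both endpoints in $S$. *)

theory Defs
  imports "HOL-Probability.Probability" "HOL-Library.Ramsey"
begin

text \<open>A simple graph on the vertex set \<open>{1..n}\<close> is given by its set of edges, a set of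
  two-element subsets of \<open>{1..n}\<close>.\<close>

definition degree :: "'a set set \<Rightarrow> 'a \<Rightarrow> nat" where
  "degree E v = card {e \<in> E. v \<in> e}"

definition regular_graphs :: "nat \<Rightarrow> nat \<Rightarrow> nat set set set" where
  "regular_graphs d n =
     {E. E \<subseteq> nsets {1..n} 2 \<and> (\<forall>v\<in>{1..n}. degree E v = d)}"

definition edges_within :: "'a set set \<Rightarrow> 'a set \<Rightarrow> nat" where
  "edges_within E S = card {e \<in> E. e \<subseteq> S}"

text \<open>The uniform law is meaningful only if \<open>regular_graphs d n\<close> is nonempty. This fails
  if \<open>n * d\<close> is odd or \<open>0 < n \<le> d\<close> (with \<open>d > 0\<close>); there \<^const>\<open>pmf_of_set\<close> has an
  unspecified value. Limits are therefore taken along \<open>admissible_sizes d\<close>, that is,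
  \<open>n \<longlongrightarrow> \<infinity>\<close> through those \<open>n\<close> with \<open>n * d\<close> even.\<close>

definition random_regular_graph :: "nat \<Rightarrow> nat \<Rightarrow> nat set set pmf" where
  "random_regular_graph d n = pmf_of_set (regular_graphs d n)"

definition admissible_sizes :: "nat \<Rightarrow> nat filter" where
  "admissible_sizes d = inf sequentially (principal {n. even (n * d)})"

end

theory Submission
  imports Defs
begin

text \<open>The proof is a first-moment argument in which the switching method replaces the independence of
edges.

Fix a set \<open>H\<close> of edges, not too large compared with \<open>n * d\<close>. In a \<open>d\<close>-regular graph that contains
\<open>H\<close>, remove an edge \<open>uv\<close> of \<open>H\<close> together with an edge \<open>xy\<close> outside \<open>H\<close>, and insert \<open>ux\<close> and \<open>vy\<close>. For most of the
\<open>n * d\<close> oriented edges \<open>xy\<close> this gives a simple \<open>d\<close>-regular graph that contains the rest of \<open>H\<close>,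
and every graph arises in at most \<open>d\<^sup>2\<close> ways. Hence each edge of \<open>H\<close> costs a factor \<open>2 * d / n\<close>, and the
random regular graph contains \<open>H\<close> with probability at most \<open>(2 * d / n) ^ card H\<close>
(\<open>card_containing_le\<close>).

If a set of \<open>s\<close> vertices spans more than \<open>(1 + \<epsilon>) * s\<close> edges, the graph contains one of the
sets of \<open>m\<close> vertex pairs inside it, where \<open>m\<close> is the least integer above \<open>(1 + \<epsilon>) * s\<close>. The union bound over the vertex sets and these sets of pairs
(\<open>card_dense_set_of_size_le\<close>) gives the probability bound
\<open>C ^ s * (exp 1 * s * d / n) ^ (m - s)\<close> with \<open>C = (exp 1)\<^sup>2 * d\<close>. As \<open>m - s > \<epsilon> * s\<close>, this is at most \<open>(1 / 2) ^ s\<close> as soon as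
\<open>s / n\<close> is small enough, and for every fixed \<open>s\<close> it tends to \<open>0\<close>. By dominated convergence for series
(Tannery's theorem), the sum over all \<open>s\<close> tends to \<open>0\<close>.

For the uniform law to be meaningful, regular graphs have to exist; circulant graphs show this
whenever \<open>d < n\<close> and \<open>n * d\<close> is even (\<open>regular_graphs_nonempty\<close>).\<close>

section \<open>Neighbourhoods in regular graphs\<close>

definition neighbours :: "'a set set \<Rightarrow> 'a \<Rightarrow> 'a set" where
  "neighbours E v = {w. {v, w} \<in> E}"

lemma card_neighbours:
  assumes "E \<subseteq> nsets V 2"
  shows "card (neighbours E v) = degree E v"
proof -
  have "bij_betw (\<lambda>w. {v, w}) (neighbours E v) {e \<in> E. v \<in> e}"
  proof (rule bij_betwI')
    fix e assume "e \<in> {e \<in> E. v \<in> e}"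
    moreover from this obtain x y where "e = {x, y}"
      using assms by (blast elim: nsets2_E)
    ultimately show "\<exists>w \<in> neighbours E v. e = {v, w}"
      by (auto simp: neighbours_def insert_commute)
  qed (auto simp: neighbours_def doubleton_eq_iff)
  then show ?thesis
    unfolding degree_def by (rule bij_betw_same_card)
qed

lemma edge_endpoints:
  assumes "E \<subseteq> nsets V 2" "{x, y} \<in> E"
  shows "x \<in> V" "y \<in> V" "x \<noteq> y"
  using subsetD[OF assms] by simp_all

lemma neighbours_subset: "E \<subseteq> nsets V 2 \<Longrightarrow> neighbours E v \<subseteq> V - {v}"
  by (auto simp: neighbours_def dest: edge_endpoints)

lemma finite_regular_graphs [simp]: "finite (regular_graphs d n)"
proof (rule finite_subset)
  show "regular_graphs d n \<subseteq> Pow (nsets {1..n} 2)"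
    by (auto simp: regular_graphs_def)
qed (simp add: finite_imp_finite_nsets)

lemma regular_graphs_edges: "E \<in> regular_graphs d n \<Longrightarrow> E \<subseteq> nsets {1..n} 2"
  by (simp add: regular_graphs_def)

lemma card_neighbours_regular:
  assumes "E \<in> regular_graphs d n" "v \<in> {1..n}"
  shows "card (neighbours E v) = d" "finite (neighbours E v)"
  using assms card_neighbours[of E "{1..n}" v] neighbours_subset[of E "{1..n}" v]
  by (auto simp: regular_graphs_def intro: finite_subset)

section \<open>Switchings\<close>

definition switch :: "'a set set \<Rightarrow> 'a \<Rightarrow> 'a \<Rightarrow> 'a \<Rightarrow> 'a \<Rightarrow> 'a set set" where
  "switch E u v x y = (E - {{u, v}, {x, y}}) \<union> {{u, x}, {v, y}}"

text \<open>The oriented edges \<open>xy\<close> that can be switched with \<open>uv\<close>; the edges of \<open>K\<close> are to be preserved.\<close>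
definition switchings :: "'a set set \<Rightarrow> 'a set set \<Rightarrow> 'a \<Rightarrow> 'a \<Rightarrow> ('a \<times> 'a) set" where
  "switchings E K u v = {(x, y). {x, y} \<in> E - K \<and>
     x \<notin> insert u (neighbours E u) \<and> y \<notin> insert v (neighbours E v)}"

text \<open>The conditions on \<open>x\<close> and \<open>y\<close> prevent both loops and double edges in the new graph: since \<open>u\<close> and \<open>v\<close>
are neighbours, also \<open>x = v\<close> and \<open>y = u\<close> are excluded.\<close>
lemma switch_distinct:
  assumes "E \<subseteq> nsets V 2" "{u, v} \<in> E" "(x, y) \<in> switchings E K u v"
  shows "distinct [u, v, x, y]" "{x, y} \<in> E" "{u, x} \<notin> E" "{v, y} \<notin> E"
proof -
  have "u \<noteq> v" "x \<noteq> y"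
    using edge_endpoints[OF assms(1)] assms(2,3) by (auto simp: switchings_def)
  then show "distinct [u, v, x, y]" "{x, y} \<in> E" "{u, x} \<notin> E" "{v, y} \<notin> E"
    using assms by (auto simp: switchings_def neighbours_def insert_commute)
qed

text \<open>The old graph is determined by the new one and the four vertices, so switching is injective
once the pair \<open>(x, y)\<close> is remembered.\<close>
lemma switch_inverse:
  assumes "E \<subseteq> nsets V 2" "{u, v} \<in> E" "(x, y) \<in> switchings E K u v"
  shows "E = (switch E u v x y - {{u, x}, {v, y}}) \<union> {{u, v}, {x, y}}"
  using switch_distinct[OF assms] assms(2) unfolding switch_def by blast

text \<open>Each of the four vertices lies on exactly one removed and exactly one added edge.\<close>
lemma degree_switch:
  assumes "finite E" "E \<subseteq> nsets V 2" "{u, v} \<in> E" "(x, y) \<in> switchings E K u v"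
  shows "degree (switch E u v x y) w = degree E w"
proof -
  note dist = switch_distinct[OF assms(2-4)]
  define C where "C = {e \<in> E - {{u, v}, {x, y}}. w \<in> e}"
  have fin: "finite C"
    using assms(1) by (simp add: C_def)
  have old: "{e \<in> E. w \<in> e} = C \<union> {e \<in> {{u, v}, {x, y}}. w \<in> e}"
    using assms(3) dist(2) by (auto simp: C_def)
  have new: "{e \<in> switch E u v x y. w \<in> e} = C \<union> {e \<in> {{u, x}, {v, y}}. w \<in> e}"
    by (auto simp: C_def switch_def)
  have "card {e \<in> {{u, v}, {x, y}}. w \<in> e} = card {e \<in> {{u, x}, {v, y}}. w \<in> e}"
  proof (cases "w \<in> {u, v, x, y}")
    case True
    have *: "{e \<in> {A, B}. w \<in> e} = (if w \<in> A then {A} else {}) \<union> (if w \<in> B then {B} else {})"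
      for A B :: "'a set"
      by auto
    show ?thesis
      unfolding * using True dist(1) by auto
  next
    case False
    then have "{e \<in> {{u, v}, {x, y}}. w \<in> e} = {}" "{e \<in> {{u, x}, {v, y}}. w \<in> e} = {}"
      by auto
    then show ?thesis by (simp only:)
  qed
  moreover have "card (C \<union> {e \<in> {{u, v}, {x, y}}. w \<in> e}) = card C + card {e \<in> {{u, v}, {x, y}}. w \<in> e}"
    using fin by (intro card_Un_disjoint) (auto simp: C_def)
  moreover have "card (C \<union> {e \<in> {{u, x}, {v, y}}. w \<in> e}) = card C + card {e \<in> {{u, x}, {v, y}}. w \<in> e}"
    using fin dist(3,4) by (intro card_Un_disjoint) (auto simp: C_def)
  ultimately show ?thesis
    unfolding degree_def old new by presburger
qed

lemma switch_regular:
  assumes "E \<in> regular_graphs d n" "{u, v} \<in> E" "(x, y) \<in> switchings E K u v"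
  shows "switch E u v x y \<in> regular_graphs d n"
proof -
  have sub: "E \<subseteq> nsets {1..n} 2"
    using assms(1) by (rule regular_graphs_edges)
  then have fin: "finite E"
    by (rule finite_subset) (simp add: finite_imp_finite_nsets)
  note dist = switch_distinct[OF sub assms(2,3)]
  have "{u, v} \<in> nsets {1..n} 2" "{x, y} \<in> nsets {1..n} 2"
    using sub assms(2) dist(2) by blast+
  then have "{u, x} \<in> nsets {1..n} 2" "{v, y} \<in> nsets {1..n} 2"
    using dist(1) by auto
  then have "switch E u v x y \<subseteq> nsets {1..n} 2"
    using sub unfolding switch_def by blast
  then show ?thesis
    using assms(1) degree_switch[OF fin sub assms(2,3)] by (simp add: regular_graphs_def)
qed

text \<open>Of the \<^term>\<open>n * d\<close> oriented edges \<open>(x, y)\<close>, at most two come from each edge of \<open>K\<close>, and at most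
\<^term>\<open>d * (d + 1)\<close> start in the closed neighbourhood of \<open>u\<close>, respectively end in that of \<open>v\<close>.\<close>
lemma card_switchings:
  assumes E: "E \<in> regular_graphs d n" and K: "finite K" and uv: "u \<in> {1..n}" "v \<in> {1..n}"
  shows "n * d \<le> card (switchings E K u v) + 2 * card K + 2 * d * (d + 1)"
proof -
  have sub: "E \<subseteq> nsets {1..n} 2"
    using E by (rule regular_graphs_edges)
  define N where "N = neighbours E"
  have N: "card (N w) = d" "finite (N w)" if "w \<in> {1..n}" for w
    using card_neighbours_regular[OF E that] by (simp_all add: N_def)
  have NV: "N w \<subseteq> {1..n}" for w
    using neighbours_subset[OF sub, of w] by (auto simp: N_def)
  have near: "finite (SIGMA x:insert w (N w). N x) \<and> card (SIGMA x:insert w (N w). N x) \<le> d * (d + 1)"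
    if "w \<in> {1..n}" for w
  proof -
    have in_V: "x \<in> {1..n}" if "x \<in> insert w (N w)" for x
      using that \<open>w \<in> {1..n}\<close> NV[of w] by blast
    have "card (SIGMA x:insert w (N w). N x) = (\<Sum>x\<in>insert w (N w). d)"
      using N in_V that by (subst card_SigmaI) auto
    also have "\<dots> \<le> d * (d + 1)"
      using N[OF that] by (cases "w \<in> N w") (simp_all add: insert_absorb)
    finally show ?thesis
      using N in_V that by (auto intro!: finite_SigmaI)
  qed
  define D where "D = (SIGMA x:{1..n}. N x)"
  define P where "P = (\<Union>e\<in>K. {(x, y). {x, y} = e})"
  have D: "card D = n * d"
    unfolding D_def using N by (subst card_SigmaI) auto
  have P: "card P \<le> 2 * card K" "finite P"
  proof -
    have two: "finite {(x, y). {x, y} = e} \<and> card {(x, y). {x, y} = e} \<le> 2" for e :: "nat set"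
    proof (cases "\<exists>a b. e = {a, b}")
      case True
      then obtain a b where "e = {a, b}" by blast
      then have "{(x, y). {x, y} = e} = {(a, b), (b, a)}"
        by (auto simp: doubleton_eq_iff)
      then show ?thesis
        using card_insert_le_m1[of 2 "{(b, a)}" "(a, b)"] by (simp only: finite.intros) simp
    next
      case False
      then have "(x, y) \<notin> {(x, y). {x, y} = e}" for x y by blast
      then have "{(x, y). {x, y} = e} = {}" by fast
      then show ?thesis by (simp only: finite.emptyI card.empty) simp
    qed
    have "card P \<le> (\<Sum>e\<in>K. card {(x, y). {x, y} = e})"
      unfolding P_def by (rule card_UN_le[OF K])
    also have "\<dots> \<le> (\<Sum>e\<in>K. 2)"
      using two by (intro sum_mono) blast
    finally show "card P \<le> 2 * card K" by simp
    show "finite P"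
      unfolding P_def using K two by blast
  qed
  define Bu where "Bu = (SIGMA x:insert u (N u). N x)"
  define Bv where "Bv = prod.swap ` (SIGMA x:insert v (N v). N x)"
  have Bu: "finite Bu" "card Bu \<le> d * (d + 1)"
    using near[OF uv(1)] by (auto simp: Bu_def)
  have Bv: "finite Bv" "card Bv \<le> d * (d + 1)"
    using near[OF uv(2)] card_image_le[of "SIGMA x:insert v (N v). N x" prod.swap]
    by (auto simp: Bv_def)
  have cover: "D \<subseteq> switchings E K u v \<union> P \<union> Bu \<union> Bv"
    by (auto simp: D_def P_def Bu_def Bv_def switchings_def N_def neighbours_def image_iff insert_commute)
  have "switchings E K u v \<subseteq> D"
    using sub by (auto simp: switchings_def D_def N_def neighbours_def dest: edge_endpoints)
  then have finS: "finite (switchings E K u v)"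
    by (rule finite_subset) (use N in \<open>auto simp: D_def\<close>)
  have "card D \<le> card (switchings E K u v \<union> P \<union> Bu \<union> Bv)"
    using cover finS P Bu Bv by (intro card_mono) auto
  also have "\<dots> \<le> card (switchings E K u v) + card P + card Bu + card Bv"
    by (meson card_Un_le add_le_mono1 order_trans)
  finally show ?thesis
    using D P Bu Bv by simp
qed

text \<open>Double counting of switchings. A graph that contains \<open>uv\<close> and \<open>H\<close> has at least
\<^term>\<open>n * d / 2\<close> switchings away from \<open>uv\<close> that leave \<open>H\<close> intact. Each of them leads to a graph that contains
\<open>H\<close> and in which \<open>x\<close> is a neighbour of \<open>u\<close> and \<open>y\<close> one of \<open>v\<close>, which leaves at most
\<^term>\<open>d\<^sup>2\<close> pairs \<open>(x, y)\<close>; together with such a pair the new graph determines the old one.\<close>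
lemma card_containing_insert:
  assumes K: "finite H" "{u, v} \<notin> H" "4 * (card H + 1) + 4 * d * (d + 1) \<le> n * d"
    and uv: "u \<in> {1..n}" "v \<in> {1..n}"
  shows "card {E \<in> regular_graphs d n. insert {u, v} H \<subseteq> E} * (n * d)
    \<le> 2 * d\<^sup>2 * card {E \<in> regular_graphs d n. H \<subseteq> E}"
proof -
  define K where "K = insert {u, v} H"
  define A where "A = {E \<in> regular_graphs d n. K \<subseteq> E}"
  define B where "B = {E \<in> regular_graphs d n. H \<subseteq> E}"
  have finK: "finite K" "card K = card H + 1"
    using assms by (auto simp: K_def)
  define \<Phi> where "\<Phi> = (\<lambda>(E, x, y). (switch E u v x y, x, y))"
  define X where "X = (SIGMA E:A. switchings E K u v)"
  define Y where "Y = (SIGMA E:B. neighbours E u \<times> neighbours E v)"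
  have E_uv: "{u, v} \<in> E" "E \<subseteq> nsets {1..n} 2" "E \<in> regular_graphs d n" if "E \<in> A" for E
    using that regular_graphs_edges by (auto simp: A_def K_def)
  have inj: "inj_on \<Phi> X"
  proof (rule inj_onI)
    fix p q assume pq: "p \<in> X" "q \<in> X" "\<Phi> p = \<Phi> q"
    obtain E x y E' where p: "p = (E, x, y)" and q: "q = (E', x, y)"
      and eq: "switch E u v x y = switch E' u v x y"
      using pq(3) unfolding \<Phi>_def by (cases p, cases q) auto
    have "E = (switch E u v x y - {{u, x}, {v, y}}) \<union> {{u, v}, {x, y}}"
      using pq(1) E_uv unfolding p X_def by (intro switch_inverse) auto
    also have "\<dots> = E'"
      unfolding eq using pq(2) E_uv unfolding q X_def by (intro switch_inverse[symmetric]) auto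
    finally show "p = q" by (simp add: p q)
  qed
  have into: "\<Phi> ` X \<subseteq> Y"
  proof
    fix q assume "q \<in> \<Phi> ` X"
    then obtain E x y where E: "E \<in> A" and xy: "(x, y) \<in> switchings E K u v"
      and q: "q = (switch E u v x y, x, y)"
      by (auto simp: X_def \<Phi>_def)
    have "H \<subseteq> switch E u v x y"
      using E xy K(2) by (auto simp: A_def K_def switch_def switchings_def)
    then show "q \<in> Y"
      using switch_regular[OF E_uv(3,1)[OF E] xy]
      by (auto simp: q Y_def B_def neighbours_def switch_def)
  qed
  have finA: "finite A" and finB: "finite B"
    by (simp_all add: A_def B_def)
  have finS: "finite (switchings E K u v)" if "E \<in> A" for E
  proof (rule finite_subset)
    show "switchings E K u v \<subseteq> {1..n} \<times> {1..n}"
      using E_uv(2)[OF that] by (auto simp: switchings_def dest: edge_endpoints)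
  qed simp
  have cardY: "card Y = card B * d\<^sup>2"
  proof -
    have "card Y = (\<Sum>E\<in>B. card (neighbours E u \<times> neighbours E v))"
      unfolding Y_def using finB card_neighbours_regular uv
      by (subst card_SigmaI) (auto simp: B_def)
    also have "\<dots> = (\<Sum>E\<in>B. d\<^sup>2)"
      using card_neighbours_regular uv
      by (intro sum.cong) (auto simp: B_def card_cartesian_product power2_eq_square)
    finally show ?thesis by simp
  qed
  have finY: "finite Y"
    unfolding Y_def using finB card_neighbours_regular uv by (intro finite_SigmaI) (auto simp: B_def)
  have "card A * (n * d) = (\<Sum>E\<in>A. n * d)"
    by simp
  also have "\<dots> \<le> (\<Sum>E\<in>A. 2 * card (switchings E K u v))"
  proof (rule sum_mono)
    fix E assume "E \<in> A"
    then have "n * d \<le> card (switchings E K u v) + 2 * card K + 2 * d * (d + 1)"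
      using card_switchings E_uv finK uv by blast
    then show "n * d \<le> 2 * card (switchings E K u v)"
      using K(3) finK by (simp add: algebra_simps)
  qed
  also have "\<dots> = 2 * card X"
    unfolding X_def using finA finS by (subst card_SigmaI) (auto simp: sum_distrib_left)
  also have "\<dots> \<le> 2 * card Y"
    using card_inj_on_le[OF inj into finY] by simp
  finally show ?thesis
    unfolding cardY A_def B_def K_def by (simp add: ac_simps)
qed

text \<open>Iterating the previous lemma, each edge of \<open>H\<close> costs a factor \<^term>\<open>2 * d / n\<close>, as if the edges were
independent up to a constant. The size condition leaves enough room for switching at every step.\<close>
lemma card_containing_le:
  assumes "finite H" "4 * card H + 4 * d * (d + 1) \<le> n * d" "n > 0" "d > 0"
  shows "real (card {E \<in> regular_graphs d n. H \<subseteq> E})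
    \<le> (2 * real d / real n) ^ card H * real (card (regular_graphs d n))"
  using assms(1,2)
proof (induction H rule: finite_induct)
  case empty
  then show ?case by simp
next
  case (insert e H)
  let ?N = "\<lambda>H. card {E \<in> regular_graphs d n. H \<subseteq> E}"
  show ?case
  proof (cases "e \<in> nsets {1..n} 2")
    case False
    then have "{E \<in> regular_graphs d n. insert e H \<subseteq> E} = {}"
      using regular_graphs_edges by blast
    then show ?thesis
      by (simp only: card.empty) simp
  next
    case True
    then obtain u v where e: "e = {u, v}" and uv: "u \<in> {1..n}" "v \<in> {1..n}"
      by (rule nsets2_E)
    have "?N (insert e H) * (n * d) \<le> 2 * d\<^sup>2 * ?N H"
      unfolding e using insert uv by (intro card_containing_insert) (auto simp: e)
    then have "real (?N (insert e H) * (n * d)) \<le> real (2 * d\<^sup>2 * ?N H)"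
      by (rule of_nat_mono)
    then have "real (?N (insert e H)) \<le> (2 * real d / real n) * real (?N H)"
      using assms(3,4) by (simp add: field_simps power2_eq_square)
    also have "\<dots> \<le> (2 * real d / real n) *
        ((2 * real d / real n) ^ card H * real (card (regular_graphs d n)))"
      using insert by (intro mult_left_mono insert.IH) auto
    finally show ?thesis
      using insert by simp
  qed
qed

section \<open>Existence of regular graphs\<close>

text \<open>The circulant graph in which \<open>v\<close> and \<open>w\<close> are adjacent iff their difference modulo \<open>n\<close> lies in the
symmetric set \<open>D\<close>: going down cyclically from \<open>v\<close> by the elements of \<open>D\<close> enumerates its neighbours.\<close>
lemma regular_graphs_circulant:
  assumes D: "D \<subseteq> {1..<n}" and sym: "\<And>x. x \<in> D \<Longrightarrow> n - x \<in> D"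
  shows "regular_graphs (card D) n \<noteq> {}"
proof -
  define E where "E = {{v, w} | v w. v \<in> {1..n} \<and> w \<in> {1..n} \<and> v < w \<and> w - v \<in> D}"
  have sub: "E \<subseteq> nsets {1..n} 2"
    by (auto simp: E_def)
  have nb: "neighbours E v = {w \<in> {1..n}. v < w \<and> w - v \<in> D \<or> w < v \<and> v - w \<in> D}"
    if "v \<in> {1..n}" for v
    using that by (auto simp: neighbours_def E_def doubleton_eq_iff)
  have "degree E v = card D" if v: "v \<in> {1..n}" for v
  proof -
    have "bij_betw (\<lambda>x. if x < v then v - x else v + (n - x)) D (neighbours E v)"
    proof (rule bij_betwI')
      fix x y assume "x \<in> D" "y \<in> D"
      then have "x \<in> {1..<n}" "y \<in> {1..<n}" using D by blast+
      then show "(if x < v then v - x else v + (n - x)) = (if y < v then v - y else v + (n - y)) \<longleftrightarrow> x = y"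
        by auto
    next
      fix x assume x: "x \<in> D"
      then have "x \<in> {1..<n}" using D by blast
      then show "(if x < v then v - x else v + (n - x)) \<in> neighbours E v"
        using v x sym[OF x] by (auto simp: nb[OF v])
    next
      fix w assume "w \<in> neighbours E v"
      then consider "w \<in> {1..n}" "v < w" "w - v \<in> D" | "w \<in> {1..n}" "w < v" "v - w \<in> D"
        using nb[OF v] by blast
      then show "\<exists>x\<in>D. w = (if x < v then v - x else v + (n - x))"
      proof cases
        case 1
        then show ?thesis
          using sym[of "w - v"] v by (intro bexI[of _ "n - (w - v)"]) auto
      next
        case 2
        then show ?thesis by (intro bexI[of _ "v - w"]) auto
      qed
    qed
    then show ?thesis
      using card_neighbours[OF sub, of v] bij_betw_same_card by fastforce
  qed
  then show ?thesis
    using sub by (auto simp: regular_graphs_def)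
qed

text \<open>The connection set consists of \<open>\<plusminus>1, \<dots>, \<plusminus>(d div 2)\<close> modulo \<open>n\<close> and, for odd \<open>d\<close>, of the antipode
\<open>n div 2\<close>, which is its own negative because \<open>n\<close> is then even.\<close>
lemma regular_graphs_nonempty:
  assumes "d < n" "even (n * d)"
  shows "regular_graphs d n \<noteq> {}"
proof -
  define j where "j = d div 2"
  define D0 where "D0 = {1..j} \<union> {n - j..<n}"
  define D where "D = (if even d then D0 else insert (n div 2) D0)"
  have j: "2 * j < n"
    using assms(1) by (simp add: j_def)
  have card_D0: "card D0 = 2 * j"
    unfolding D0_def using j by (subst card_Un_disjoint) auto
  have D0: "D0 \<subseteq> {1..<n}" "\<And>x. x \<in> D0 \<Longrightarrow> n - x \<in> D0"
    using j unfolding D0_def by (force, simp, linarith)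
  have D: "D \<subseteq> {1..<n} \<and> (\<forall>x\<in>D. n - x \<in> D) \<and> card D = d"
  proof (cases "even d")
    case True
    then have "D = D0" "2 * j = d"
      by (auto simp: D_def j_def)
    then show ?thesis
      using D0 card_D0 by simp
  next
    case False
    then obtain h where n: "n = 2 * h"
      using assms(2) by auto
    have d: "d = 2 * j + 1"
      using False by (simp add: j_def)
    have DI: "D = insert h D0"
      using False n by (simp add: D_def)
    have "h \<notin> D0"
      using n d assms(1) by (simp add: D0_def)
    moreover have "finite D0"
      by (simp add: D0_def)
    ultimately have "card D = d"
      using card_D0 d DI by simp
    moreover have "h \<in> {1..<n}" "n - h = h"
      using n assms(1) by auto
    ultimately show ?thesis
      using D0 DI by simp
  qed
  then show ?thesis
    using regular_graphs_circulant[of D n] by auto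
qed

section \<open>Counting dense vertex sets\<close>

text \<open>The left-hand side divided by \<^term>\<open>fact n\<close> is one of the summands of the exponential series at \<open>n\<close>.\<close>
lemma power_self_le_exp_fact: "real n ^ n \<le> exp 1 ^ n * fact n"
proof -
  have "(\<Sum>k\<in>{n}. real n ^ k /\<^sub>R fact k) \<le> exp (real n)"
    unfolding exp_def using summable_exp_generic[of "real n"] by (intro sum_le_suminf) auto
  then have "real n ^ n \<le> exp (real n) * fact n"
    by (simp add: field_simps)
  then show ?thesis
    by (simp add: exp_of_nat_mult[of n 1, simplified])
qed

lemma binomial_le_exp_power: "real (a choose k) \<le> (exp 1 * real a / real k) ^ k"
proof (cases "k = 0")
  case False
  have "real (a choose k) * real k ^ k \<le> real (a choose k) * (exp 1 ^ k * fact k)"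
    by (intro mult_left_mono power_self_le_exp_fact) auto
  also have "\<dots> = exp 1 ^ k * real ((a choose k) * fact k)"
    by simp
  also have "\<dots> \<le> exp 1 ^ k * real (a ^ k)"
    by (intro mult_left_mono of_nat_mono binomial_fact_pow) auto
  finally show ?thesis
    using False by (simp add: power_divide power_mult_distrib field_simps)
qed simp

text \<open>The left-hand side is the union bound over the \<open>s\<close>-sets of vertices and the sets of \<open>m\<close> vertex pairs
inside them, with the probability bound from switching for each. On the right, \<open>s\<close> of the \<open>m\<close> edge factors have absorbed the choice of the
vertex set, whose \<open>(n / s) ^ s\<close> they cancel; what is gained from a density above \<open>1\<close> is
the small factor for each of the remaining \<^term>\<open>m - s\<close> edges.\<close>
lemma binomial_product_le:
  fixes d :: nat
  assumes "0 < s" "s \<le> m" "0 < n"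
  shows "real (n choose s) * real ((s choose 2) choose m) * (2 * real d / real n) ^ m
    \<le> ((exp 1)\<^sup>2 * real d) ^ s * (exp 1 * real s * real d / real n) ^ (m - s)"
proof -
  have "real ((s choose 2) choose m) \<le> (exp 1 * real (s choose 2) / real m) ^ m"
    by (rule binomial_le_exp_power)
  also have "\<dots> \<le> (exp 1 * real s / 2) ^ m"
  proof (rule power_mono)
    \<comment> \<open>There are at most \<open>s\<^sup>2 / 2 \<le> s * m / 2\<close> pairs of vertices.\<close>
    have "2 * (s choose 2) \<le> s * s"
      unfolding choose_two
      by (rule order_trans[OF times_div_less_eq_dividend]) simp
    then have "2 * real (s choose 2) \<le> real s * real s"
      by (metis of_nat_le_iff of_nat_mult of_nat_numeral)
    also have "\<dots> \<le> real s * real m"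
      using assms by (intro mult_left_mono) auto
    finally show "exp 1 * real (s choose 2) / real m \<le> exp 1 * real s / 2"
      using assms by (simp add: field_simps)
  qed auto
  finally have "real (n choose s) * real ((s choose 2) choose m) * (2 * real d / real n) ^ m
    \<le> (exp 1 * real n / real s) ^ s * (exp 1 * real s / 2) ^ m * (2 * real d / real n) ^ m"
    by (intro mult_right_mono mult_mono binomial_le_exp_power) auto
  also have "\<dots> = (exp 1 * real n / real s) ^ s * (exp 1 * real s * real d / real n) ^ m"
    by (simp add: power_mult_distrib[symmetric] mult.assoc)
  also have "\<dots> = (exp 1 * real n / real s) ^ s *
      ((exp 1 * real s * real d / real n) ^ s * (exp 1 * real s * real d / real n) ^ (m - s))"
    using assms by (simp flip: power_add)
  also have "\<dots> = ((exp 1 * real n / real s) * (exp 1 * real s * real d / real n)) ^ s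
      * (exp 1 * real s * real d / real n) ^ (m - s)"
    by (simp only: power_mult_distrib mult.assoc)
  also have "(exp 1 * real n / real s) * (exp 1 * real s * real d / real n) = (exp 1)\<^sup>2 * real d"
    using assms by (simp add: field_simps power2_eq_square)
  finally show ?thesis .
qed

text \<open>Union bound over the vertex set \<open>S\<close> and over the \<open>m\<close> edges inside it.\<close>
lemma card_dense_set_of_size_le:
  assumes s: "0 < s" "s \<le> m" and small: "4 * m + 4 * d * (d + 1) \<le> n * d" "n > 0" "d > 0"
  shows "real (card {E \<in> regular_graphs d n. \<exists>S \<in> nsets {1..n} s. m \<le> edges_within E S})
    \<le> ((exp 1)\<^sup>2 * real d) ^ s * (exp 1 * real s * real d / real n) ^ (m - s)
       * real (card (regular_graphs d n))"
proof -
  let ?R = "regular_graphs d n"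
  define I where "I = (SIGMA S:nsets {1..n} s. nsets (nsets S 2) m)"
  have fin: "finite (nsets (nsets S 2) m)"
    and card: "card (nsets (nsets S 2) m) = (s choose 2) choose m" if "S \<in> nsets {1..n} s" for S
  proof -
    have "finite S" "card S = s"
      using that by (simp_all add: nsets_def)
    then show "finite (nsets (nsets S 2) m)" "card (nsets (nsets S 2) m) = (s choose 2) choose m"
      by (simp_all add: finite_imp_finite_nsets)
  qed
  have finI: "finite I"
    unfolding I_def using fin by (intro finite_SigmaI) (auto intro!: finite_imp_finite_nsets)
  have "card I = (\<Sum>S\<in>nsets {1..n} s. card (nsets (nsets S 2) m))"
    unfolding I_def using fin by (intro card_SigmaI) (auto intro!: finite_imp_finite_nsets)
  also have "\<dots> = (\<Sum>S\<in>nsets {1..n} s. (s choose 2) choose m)"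
    using card by (rule sum.cong[OF refl])
  finally have cardI: "card I = (n choose s) * ((s choose 2) choose m)"
    by simp
  have "{E \<in> ?R. \<exists>S \<in> nsets {1..n} s. m \<le> edges_within E S} \<subseteq> (\<Union>(S, H)\<in>I. {E \<in> ?R. H \<subseteq> E})"
  proof
    fix E assume "E \<in> {E \<in> ?R. \<exists>S \<in> nsets {1..n} s. m \<le> edges_within E S}"
    then obtain S where E: "E \<in> ?R" and S: "S \<in> nsets {1..n} s" and "m \<le> card {e \<in> E. e \<subseteq> S}"
      by (auto simp: edges_within_def)
    then obtain H where H: "H \<subseteq> {e \<in> E. e \<subseteq> S}" "card H = m" "finite H"
      by (elim obtain_subset_with_card_n)
    have "H \<subseteq> nsets S 2"
    proof
      fix e assume "e \<in> H"
      then have "e \<in> nsets {1..n} 2" "e \<subseteq> S"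
        using H(1) regular_graphs_edges[OF E] by auto
      then show "e \<in> nsets S 2"
        by (simp add: nsets_def)
    qed
    then have "(S, H) \<in> I"
      using H S by (simp add: I_def nsets_def[of _ m])
    then show "E \<in> (\<Union>(S, H)\<in>I. {E \<in> ?R. H \<subseteq> E})"
      using E H by blast
  qed
  then have "card {E \<in> ?R. \<exists>S \<in> nsets {1..n} s. m \<le> edges_within E S}
      \<le> card (\<Union>(S, H)\<in>I. {E \<in> ?R. H \<subseteq> E})"
    using finI by (intro card_mono) auto
  also have "\<dots> \<le> (\<Sum>(S, H)\<in>I. card {E \<in> ?R. H \<subseteq> E})"
    using card_UN_le[OF finI, of "\<lambda>(S, H). {E \<in> ?R. H \<subseteq> E}"] by (simp add: case_prod_unfold)
  finally have "real (card {E \<in> ?R. \<exists>S \<in> nsets {1..n} s. m \<le> edges_within E S})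
      \<le> real (\<Sum>(S, H)\<in>I. card {E \<in> ?R. H \<subseteq> E})"
    by (rule of_nat_mono)
  also have "\<dots> = (\<Sum>(S, H)\<in>I. real (card {E \<in> ?R. H \<subseteq> E}))"
    by (simp add: case_prod_unfold)
  also have "\<dots> \<le> (\<Sum>(S, H)\<in>I. (2 * real d / real n) ^ m * real (card ?R))"
  proof (rule sum_mono, clarify)
    fix S H assume "(S, H) \<in> I"
    then have "finite H" "card H = m"
      by (auto simp: I_def nsets_def)
    then show "real (card {E \<in> ?R. H \<subseteq> E}) \<le> (2 * real d / real n) ^ m * real (card ?R)"
      using card_containing_le[of H d n] small by simp
  qed
  also have "\<dots> = real (n choose s) * real ((s choose 2) choose m) * (2 * real d / real n) ^ m
      * real (card ?R)"
    by (simp add: cardI)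
  also have "\<dots> \<le> ((exp 1)\<^sup>2 * real d) ^ s * (exp 1 * real s * real d / real n) ^ (m - s)
      * real (card ?R)"
    using s small by (intro mult_right_mono binomial_product_le) auto
  finally show ?thesis .
qed

section \<open>Sparsity of small vertex sets\<close>

theorem corollary4p4:
  fixes d :: nat and \<epsilon> :: real
  assumes "d \<ge> 3" and "\<epsilon> > 0"
  shows "\<exists>\<eta>::real. \<eta> > 0 \<and>
    ((\<lambda>n. measure_pmf.prob (random_regular_graph d n)
        {E. \<forall>S. S \<subseteq> {1..n} \<and> real (card S) \<le> \<eta> * real n \<longrightarrow>
              real (edges_within E S) \<le> (1 + \<epsilon>) * real (card S)})
      \<longlongrightarrow> 1) (admissible_sizes d)"
proof -
  \<comment> \<open>The least number of edges that violates the bound for a set of size \<open>s\<close>.\<close>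
  define m where "m s = nat \<lfloor>(1 + \<epsilon>) * real s\<rfloor> + 1" for s :: nat
  define C where "C = (exp 1)\<^sup>2 * real d"
  \<comment> \<open>Chosen such that \<open>C * \<delta> powr \<epsilon> = 1 / 2\<close>: this is the ratio of the geometric series that
    dominates the union bound.\<close>
  define \<delta> where "\<delta> = (1 / (2 * C)) powr (1 / \<epsilon>)"
  \<comment> \<open>For \<open>s \<le> \<eta> * n\<close>, the first bound makes \<open>exp 1 * s * d / n\<close> at most \<open>\<delta>\<close>; the second one makes
    \<open>4 * m s\<close> at most \<open>n * d / 2\<close>, as the switching estimate requires.\<close>
  define \<eta> where "\<eta> = min (\<delta> / (exp 1 * real d)) (real d / (8 * (2 + \<epsilon>)))"
  \<comment> \<open>The bound on the probability that some set of size \<open>s\<close> is too dense.\<close>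
  define a where "a s n = (if 0 < s \<and> real s \<le> \<eta> * real n
      then C ^ s * (exp 1 * real s * real d / real n) ^ (m s - s) else 0)" for s n :: nat
  define good where "good n = {E. \<forall>S. S \<subseteq> {1..n} \<and> real (card S) \<le> \<eta> * real n \<longrightarrow>
              real (edges_within E S) \<le> (1 + \<epsilon>) * real (card S)}" for n :: nat
  have C: "C \<ge> 1"
  proof -
    have "1 * 1 \<le> (exp 1)\<^sup>2 * real d"
      using assms(1) by (intro mult_mono) auto
    then show ?thesis by (simp add: C_def)
  qed
  have \<delta>: "0 < \<delta>" "\<delta> \<le> 1"
    using C assms(2) by (auto simp: \<delta>_def intro: powr_le1)
  have \<delta>_powr: "C * \<delta> powr \<epsilon> = 1 / 2"
    using C assms(2) by (simp add: \<delta>_def powr_powr)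
  have \<eta>: "\<eta> > 0"
    using \<delta> assms by (simp add: \<eta>_def)

  have m_gt: "(1 + \<epsilon>) * real s < real (m s)" for s
    unfolding m_def using assms(2) by (simp add: add.commute) linarith
  have m_le: "real (m s) \<le> (2 + \<epsilon>) * real s" if "0 < s" for s
  proof -
    have "real (m s) \<le> (1 + \<epsilon>) * real s + 1"
      unfolding m_def using assms(2) by simp
    also have "\<dots> \<le> (2 + \<epsilon>) * real s"
      using that by (simp add: algebra_simps)
    finally show ?thesis .
  qed
  have s_less_m: "s < m s" for s
  proof -
    have "real s \<le> (1 + \<epsilon>) * real s"
      using assms(2) by (simp add: algebra_simps)
    then show ?thesis
      using m_gt[of s] by linarith
  qed
  have m_leI: "m s \<le> k" if "(1 + \<epsilon>) * real s < real k" for s k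
  proof -
    have "\<lfloor>(1 + \<epsilon>) * real s\<rfloor> < int k"
      using that by (simp add: floor_less_iff)
    moreover have "0 \<le> \<lfloor>(1 + \<epsilon>) * real s\<rfloor>"
      using assms(2) by simp
    ultimately show ?thesis
      unfolding m_def by linarith
  qed

  \<comment> \<open>There are more than \<open>\<epsilon> * s\<close> excess edges, each of which contributes a factor of at most \<open>\<delta>\<close>.\<close>
  have a_le: "a s n \<le> (1 / 2) ^ s" and a_nonneg: "0 \<le> a s n" for s n
  proof -
    show "0 \<le> a s n"
      using C by (simp add: a_def)
    show "a s n \<le> (1 / 2) ^ s"
    proof (cases "0 < s \<and> real s \<le> \<eta> * real n")
      case True
      then have n: "n > 0"
        by (cases n) auto
      have "real s \<le> \<delta> / (exp 1 * real d) * real n"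
        using True by (smt (verit) \<eta>_def mult_right_mono of_nat_0_le_iff)
      then have "exp 1 * real s * real d / real n \<le> \<delta>"
        using n assms(1) by (simp add: field_simps)
      then have "(exp 1 * real s * real d / real n) ^ (m s - s) \<le> \<delta> ^ (m s - s)"
        by (intro power_mono) auto
      also have "\<dots> = \<delta> powr real (m s - s)"
        using \<delta> by (simp add: powr_realpow)
      also have "\<dots> \<le> \<delta> powr (\<epsilon> * real s)"
      proof (rule powr_mono')
        show "\<epsilon> * real s \<le> real (m s - s)"
          using m_gt[of s] s_less_m[of s] by (simp add: of_nat_diff algebra_simps)
      qed (use \<delta> in auto)
      also have "\<dots> = (\<delta> powr \<epsilon>) ^ s"
        using \<delta> by (simp add: powr_powr[symmetric] powr_realpow)
      finally have "a s n \<le> C ^ s * (\<delta> powr \<epsilon>) ^ s"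
        using True C by (simp add: a_def)
      also have "\<dots> = (1 / 2) ^ s"
        by (simp only: power_mult_distrib[symmetric] \<delta>_powr)
      finally show ?thesis .
    qed (auto simp: a_def)
  qed
  have a_summable: "summable (\<lambda>s. a s n)" for n
    by (rule summable_comparison_test'[of "\<lambda>s. (1 / 2 :: real) ^ s" 0])
      (use a_le a_nonneg in auto)
  \<comment> \<open>For fixed \<open>s\<close> there is at least one excess edge, which contributes a factor of order \<open>1 / n\<close>.\<close>
  have a_tendsto: "(\<lambda>n. a s n) \<longlonglongrightarrow> 0" for s
  proof (rule tendsto_sandwich)
    show "\<forall>\<^sub>F n in sequentially. 0 \<le> a s n"
      using a_nonneg by simp
    show "\<forall>\<^sub>F n in sequentially. a s n \<le> C ^ s * (exp 1 * real s * real d / real n) ^ (m s - s)"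
      using C by (simp add: a_def)
    have "(\<lambda>n. exp 1 * real s * real d / real n) \<longlonglongrightarrow> 0"
      by (rule tendsto_divide_0[OF tendsto_const])
        (simp add: filterlim_at_top_imp_at_infinity filterlim_real_sequentially)
    from tendsto_mult[OF tendsto_const[of "C ^ s"] tendsto_power[OF this, of "m s - s"]]
    have "(\<lambda>n. C ^ s * (exp 1 * real s * real d / real n) ^ (m s - s)) \<longlonglongrightarrow> C ^ s * 0 ^ (m s - s)" .
    moreover have "C ^ s * 0 ^ (m s - s) = 0"
      using s_less_m[of s] by simp
    ultimately show "(\<lambda>n. C ^ s * (exp 1 * real s * real d / real n) ^ (m s - s)) \<longlonglongrightarrow> 0"
      by (simp only:)
  qed simp
  have "(\<lambda>n. \<Sum>s. a s n) \<longlonglongrightarrow> (\<Sum>s. 0)"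
    using tannerys_theorem[of a "\<lambda>_. 0" sequentially "\<lambda>s. (1 / 2) ^ s"] a_tendsto a_le a_nonneg
    by (simp add: case_prod_unfold summable_geometric)
  then have sum_tendsto: "(\<lambda>n. \<Sum>s. a s n) \<longlonglongrightarrow> 0"
    by simp

  \<comment> \<open>The threshold on \<open>n\<close> makes the term \<open>4 * d * (d + 1)\<close> in the switching condition at most
    \<open>n * d / 2\<close>, and it is large enough for regular graphs to exist.\<close>
  have prob_good_ge: "1 - (\<Sum>s. a s n) \<le> measure_pmf.prob (random_regular_graph d n) (good n)"
    if n: "n \<ge> 8 * (d + 1)" "even (n * d)" for n
  proof -
    let ?R = "regular_graphs d n"
    define B where "B s = {E \<in> ?R. \<exists>S \<in> nsets {1..n} s. m s \<le> edges_within E S}" for s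
    define I where "I = {s \<in> {1..n}. real s \<le> \<eta> * real n}"
    have ne: "?R \<noteq> {}"
      using n by (intro regular_graphs_nonempty) auto
    then have R: "real (card ?R) > 0"
      by (simp add: card_gt_0_iff)
    have cover: "?R - good n \<subseteq> (\<Union>s\<in>I. B s)"
    proof
      fix E assume "E \<in> ?R - good n"
      then obtain S where E: "E \<in> ?R" and S: "S \<subseteq> {1..n}" "real (card S) \<le> \<eta> * real n"
        and dense: "(1 + \<epsilon>) * real (card S) < real (edges_within E S)"
        by (auto simp: good_def not_le)
      have finS: "finite S"
        using S(1) finite_subset by blast
      \<comment> \<open>The empty set spans no edge, so the union bound may start at \<open>s = 1\<close>.\<close>
      have "S \<noteq> {}"
      proof
        assume "S = {}"
        have "{} \<notin> E"
          using regular_graphs_edges[OF E] by (auto simp: nsets_def)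
        then have "edges_within E {} = 0"
          by (auto simp: edges_within_def)
        then show False
          using dense \<open>S = {}\<close> by simp
      qed
      then have "card S \<in> I"
        using S finS card_mono[OF _ S(1)] by (auto simp: I_def Suc_le_eq card_gt_0_iff)
      moreover have "E \<in> B (card S)"
        using E S finS m_leI[OF dense] by (auto simp: B_def nsets_def)
      ultimately show "E \<in> (\<Union>s\<in>I. B s)"
        by blast
    qed
    have cardB: "real (card (B s)) \<le> a s n * real (card ?R)" if "s \<in> I" for s
    proof -
      have s: "0 < s" "real s \<le> \<eta> * real n"
        using that by (auto simp: I_def)
      have "4 * real (m s) \<le> 4 * ((2 + \<epsilon>) * real s)"
        using m_le s(1) by simp
      also have "\<dots> \<le> 4 * ((2 + \<epsilon>) * (real d / (8 * (2 + \<epsilon>)) * real n))"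
      proof -
        have "real s \<le> real d / (8 * (2 + \<epsilon>)) * real n"
          using s(2) by (smt (verit) \<eta>_def mult_right_mono of_nat_0_le_iff)
        then show ?thesis
          using assms(2) by (intro mult_left_mono) auto
      qed
      also have "\<dots> = real (n * d) / 2"
        using assms(2) by (simp add: field_simps)
      finally have "8 * m s \<le> n * d"
        by linarith
      moreover have "8 * (d + 1) * d \<le> n * d"
        using n(1) by (rule mult_le_mono1)
      ultimately have "4 * m s + 4 * d * (d + 1) \<le> n * d"
        by (simp add: algebra_simps)
      then show ?thesis
        using card_dense_set_of_size_le[of s "m s" d n] s s_less_m[of s] n assms(1)
        by (simp add: B_def a_def C_def)
    qed
    have "card (?R - good n) \<le> card (\<Union>s\<in>I. B s)"
      using cover by (intro card_mono) (auto simp: I_def B_def)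
    also have "\<dots> \<le> (\<Sum>s\<in>I. card (B s))"
      by (intro card_UN_le) (simp add: I_def)
    finally have "real (card (?R - good n)) \<le> (\<Sum>s\<in>I. real (card (B s)))"
      by (metis of_nat_le_iff of_nat_sum)
    also have "\<dots> \<le> (\<Sum>s\<in>I. a s n * real (card ?R))"
      using cardB by (rule sum_mono)
    also have "\<dots> = (\<Sum>s\<in>I. a s n) * real (card ?R)"
      by (simp add: sum_distrib_right)
    also have "\<dots> \<le> (\<Sum>s. a s n) * real (card ?R)"
      using a_summable a_nonneg by (intro mult_right_mono sum_le_suminf) (auto simp: I_def)
    finally have few: "real (card (?R - good n)) \<le> (\<Sum>s. a s n) * real (card ?R)" .
    have "card ?R = card (?R \<inter> good n) + card (?R - good n)"
      by (subst card_Un_disjoint[symmetric]) (auto intro!: arg_cong[of _ _ card])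
    then have "real (card ?R) - real (card (?R - good n)) = real (card (?R \<inter> good n))"
      by simp
    then have "1 - real (card (?R - good n)) / real (card ?R) = real (card (?R \<inter> good n)) / real (card ?R)"
      using R by (simp add: field_simps)
    also have "\<dots> = measure_pmf.prob (random_regular_graph d n) (good n)"
      unfolding random_regular_graph_def using ne by (simp add: measure_pmf_of_set)
    finally show ?thesis
      using few R by (simp flip: pos_divide_le_eq)
  qed

  have "((\<lambda>n. measure_pmf.prob (random_regular_graph d n) (good n)) \<longlongrightarrow> 1) (admissible_sizes d)"
  proof (rule tendsto_sandwich)
    have "(\<lambda>n. 1 - (\<Sum>s. a s n)) \<longlonglongrightarrow> 1"
      using tendsto_diff[OF tendsto_const[of 1] sum_tendsto] by simp
    then show "((\<lambda>n. 1 - (\<Sum>s. a s n)) \<longlongrightarrow> 1) (admissible_sizes d)"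
      unfolding admissible_sizes_def by (rule filterlim_mono) auto
    show "\<forall>\<^sub>F n in admissible_sizes d.
        1 - (\<Sum>s. a s n) \<le> measure_pmf.prob (random_regular_graph d n) (good n)"
      unfolding admissible_sizes_def eventually_inf_principal
      using eventually_ge_at_top[of "8 * (d + 1)"] by eventually_elim (use prob_good_ge in auto)
  qed auto
  then show ?thesis
    using \<eta> unfolding good_def by blast
qed

end
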